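(* Assume Martin's Axiom. Then there exists a $\gamma$-set $X\subseteq 2^{\omega}$ that is not a weak $\lambda$-set.
   Context: A cover $\mathcal{U}$ of a set $X$ is an $\omega$-cover if each finite set $F\subseteq X$ is contained in some $U\in\mathcal{U}$; it is a $\gamma$-cover if for every $x\in X$ the set $\{U\in\mathcal{U}: x\notin U\}$ is finite. A set $X\subseteq 2^{\omega}$ (with the subspace topology) is a $\gamma$-set if each open $\omega$-cover $\mathcal{U}$ of $X$ contains a $\gamma$-subcover of $X$. A set $X\subseteq 2^\omega$ is a weak $\lambda$-set if for every pair of disjoint countable sets $Y,Z\subseteq X$ there exists a set $H\subseteq X$ that is both a $G_\delta$-set and an $F_\sigma$-set in $X$ such that $Y\subseteq H$ and $Z\subseteq X\setminus H$. *)

theory Defs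
  imports "HOL-Analysis.Analysis"
begin

section \<open>Martin's Axiom\<close>

text \<open>
  A forcing poset is a carrier \<open>P\<close> with an order relation \<open>r\<close> (in the sense of
  \<open>HOL.Order_Relation\<close>); \<open>(p, q) \<in> r\<close> means that \<open>p\<close> extends \<open>q\<close>, i.e. \<open>p \<le> q\<close>.
\<close>

definition compatible_in :: "'p set \<Rightarrow> 'p rel \<Rightarrow> 'p \<Rightarrow> 'p \<Rightarrow> bool" where
  "compatible_in P r p q \<longleftrightarrow> (\<exists>s\<in>P. (s, p) \<in> r \<and> (s, q) \<in> r)"

definition ccc :: "'p set \<Rightarrow> 'p rel \<Rightarrow> bool" where
  "ccc P r \<longleftrightarrow>
    (\<forall>A\<subseteq>P. (\<forall>p\<in>A. \<forall>q\<in>A. p \<noteq> q \<longrightarrow> \<not> compatible_in P r p q) \<longrightarrow> countable A)"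

definition dense_in_poset :: "'p set \<Rightarrow> 'p rel \<Rightarrow> 'p set \<Rightarrow> bool" where
  "dense_in_poset P r D \<longleftrightarrow> D \<subseteq> P \<and> (\<forall>p\<in>P. \<exists>d\<in>D. (d, p) \<in> r)"

definition filter_in_poset :: "'p set \<Rightarrow> 'p rel \<Rightarrow> 'p set \<Rightarrow> bool" where
  "filter_in_poset P r G \<longleftrightarrow>
    G \<subseteq> P \<and> G \<noteq> {} \<and>
    (\<forall>p\<in>G. \<forall>q\<in>P. (p, q) \<in> r \<longrightarrow> q \<in> G) \<and>
    (\<forall>p\<in>G. \<forall>q\<in>G. \<exists>s\<in>G. (s, p) \<in> r \<and> (s, q) \<in> r)"

text \<open>
  Types cannot be quantified inside a formula, so Martin's Axiom is stated for the posets whose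
  underlying set consists of elements of a given type. If that type has cardinality continuum,
  these are, up to isomorphism, exactly the posets of size at most continuum; by the usual
  reduction to posets of size less than continuum this is equivalent to the axiom for all posets.
\<close>

definition martins_axiom_on :: "'p itself \<Rightarrow> bool" where
  "martins_axiom_on _ \<longleftrightarrow>
    (\<forall>(P :: 'p set) r \<D>.
      P \<noteq> {} \<and> partial_order_on P r \<and> ccc P r \<and>
      \<D> \<prec> (UNIV :: (nat \<Rightarrow> bool) set) \<and> (\<forall>D\<in>\<D>. dense_in_poset P r D) \<longrightarrow>
      (\<exists>G. filter_in_poset P r G \<and> (\<forall>D\<in>\<D>. G \<inter> D \<noteq> {})))"

definition martins_axiom :: bool where
  "martins_axiom \<longleftrightarrow> martins_axiom_on TYPE(nat \<Rightarrow> bool)"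


section \<open>\<open>\<gamma>\<close>-sets\<close>

text \<open>
  The usual nontriviality conventions are made explicit: an \<open>\<omega>\<close>-cover of \<open>X\<close> does not have \<open>X\<close>
  itself as a member, and a \<open>\<gamma>\<close>-cover is infinite. Without them every finite cover would be a
  \<open>\<gamma>\<close>-cover and hence every compact set, e.g. the whole Cantor space, a \<open>\<gamma>\<close>-set. The resulting
  notion of \<open>\<gamma>\<close>-set implies the one without these conventions, see \<open>gamma_setD\<close> below.
\<close>

definition omega_cover :: "'a set \<Rightarrow> 'a set set \<Rightarrow> bool" where
  "omega_cover X \<U> \<longleftrightarrow>
    X \<subseteq> \<Union>\<U> \<and> X \<notin> \<U> \<and> (\<forall>F. finite F \<and> F \<subseteq> X \<longrightarrow> (\<exists>U\<in>\<U>. F \<subseteq> U))"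

definition gamma_cover :: "'a set \<Rightarrow> 'a set set \<Rightarrow> bool" where
  "gamma_cover X \<U> \<longleftrightarrow>
    X \<subseteq> \<Union>\<U> \<and> infinite \<U> \<and> (\<forall>x\<in>X. finite {U \<in> \<U>. x \<notin> U})"

definition gamma_set :: "'a::topological_space set \<Rightarrow> bool" where
  "gamma_set X \<longleftrightarrow>
    (\<forall>\<U>. (\<forall>U\<in>\<U>. openin (top_of_set X) U) \<and> omega_cover X \<U> \<longrightarrow>
      (\<exists>\<V>\<subseteq>\<U>. gamma_cover X \<V>))"

lemma gamma_setD:
  assumes "gamma_set X"
    and op: "\<forall>U\<in>\<U>. openin (top_of_set X) U"
    and cov: "X \<subseteq> \<Union>\<U>"
    and fin: "\<forall>F. finite F \<and> F \<subseteq> X \<longrightarrow> (\<exists>U\<in>\<U>. F \<subseteq> U)"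
  shows "\<exists>\<V>\<subseteq>\<U>. X \<subseteq> \<Union>\<V> \<and> (\<forall>x\<in>X. finite {U \<in> \<V>. x \<notin> U})"
proof (cases "X \<in> \<U>")
  case True
  have "{U \<in> {X}. x \<notin> U} = {}" if "x \<in> X" for x
    using that by blast
  then have "\<forall>x\<in>X. finite {U \<in> {X}. x \<notin> U}"
    by (metis finite.emptyI)
  with True show ?thesis
    by (intro exI[of _ "{X}"]) simp
next
  case False
  with assms have "\<exists>\<V>\<subseteq>\<U>. gamma_cover X \<V>"
    unfolding gamma_set_def omega_cover_def by blast
  then show ?thesis
    unfolding gamma_cover_def by blast
qed


section \<open>Weak \<open>\<lambda>\<close>-sets\<close>

definition weak_lambda_set :: "'a::topological_space set \<Rightarrow> bool" where
  "weak_lambda_set X \<longleftrightarrow>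
    (\<forall>Y Z. Y \<subseteq> X \<and> Z \<subseteq> X \<and> countable Y \<and> countable Z \<and> Y \<inter> Z = {} \<longrightarrow>
      (\<exists>H\<subseteq>X. gdelta_in (top_of_set X) H \<and> fsigma_in (top_of_set X) H \<and>
        Y \<subseteq> H \<and> Z \<subseteq> X - H))"

end

theory Submission
  imports Defs
begin

text \<open>
  Points of \<open>2\<^sup>\<omega>\<close> are identified with subsets of \<open>\<omega>\<close>. The set \<open>X\<close> consists of all finite
  subsets of \<open>\<omega>\<close> together with infinite sets \<open>x\<^sub>a\<close>, where \<open>a\<close> runs through \<open>2\<^sup>\<omega>\<close> in a
  well-order of type continuum and the \<open>x\<^sub>a\<close> decrease modulo finite sets (the construction of
  Galvin and Miller). Being able to continue a decreasing tower of length less than the continuum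
  is a consequence of Martin's Axiom (\<open>MA_pseudointersection\<close>).

  The set is a \<open>\<gamma>\<close>-set because covers can be treated one at a time. Refining by clopen cylinders,
  of which there are countably many, leaves only continuum many covers. At stage \<open>a\<close>, if the cover
  coded by \<open>a\<close> is an \<open>\<omega>\<close>-cover of the part of \<open>X\<close> built so far, Martin's Axiom makes it contain a
  \<open>\<gamma>\<close>-sequence for that part, and \<open>x\<^sub>a\<close> can be chosen so sparse that a subsequence is a
  \<open>\<gamma>\<close>-sequence also for every subset, modulo finite sets, of \<open>x\<^sub>a\<close> (\<open>thin_to_gamma\<close>). All later
  points are of this kind, so they cannot destroy the \<open>\<gamma>\<close>-sequence.

  The set is not a weak \<open>\<lambda>\<close>-set because the finite sets \<open>Y\<close> of even size cannot be separated from
  the finite sets \<open>Z\<close> of odd size. A set that is both \<open>G\<^sub>\<delta>\<close> and \<open>F\<^sub>\<sigma>\<close> in \<open>X\<close> and separates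
  them yields \<open>G\<^sub>\<delta>\<close>-sets \<open>G \<supseteq> Y\<close> and \<open>G' \<supseteq> Z\<close> with \<open>X \<inter> G \<inter> G' = {}\<close>. But inside every infinite
  set, finite sets of either parity are dense, so every infinite set has an infinite subset in
  \<open>G \<inter> G'\<close> (\<open>infinite_subset_in_all_open\<close>). There are only continuum many such pairs, and stage \<open>a\<close>
  also puts \<open>x\<^sub>a\<close> into \<open>G \<inter> G'\<close> for the pair coded by \<open>a\<close>.
\<close>

section \<open>Cardinalities below the continuum\<close>

lemma lesspoll_iff_card_of_ordLess: "A \<prec> B \<longleftrightarrow> (card_of A, card_of B) \<in> ordLess"
proof -
  have "A \<prec> B \<longleftrightarrow> \<not> B \<lesssim> A"
    by (metis lepoll_antisym lesspoll_def eqpoll_imp_lepoll eqpoll_sym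
        lepoll_def card_of_ordLeq card_of_Well_order ordLeq_total)
  then show ?thesis
    unfolding lepoll_def by (metis card_of_ordLess)
qed

lemma lesspoll_Un:
  assumes "infinite C" "A \<prec> C" "B \<prec> C"
  shows "A \<union> B \<prec> C"
  using assms card_of_Un_ordLess_infinite unfolding lesspoll_iff_card_of_ordLess by blast

lemma image_lesspoll: "A \<prec> C \<Longrightarrow> f ` A \<prec> C"
  by (meson image_lepoll lesspoll_trans1)

lemma uncountable_Cantor: "uncountable (UNIV :: (nat \<Rightarrow> bool) set)"
proof
  assume "countable (UNIV :: (nat \<Rightarrow> bool) set)"
  then obtain F :: "nat \<Rightarrow> nat \<Rightarrow> bool" where "range F = UNIV"
    by (metis UNIV_not_empty range_from_nat_into)
  then obtain n where "F n = (\<lambda>k. \<not> F k k)"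
    by (metis UNIV_I imageE)
  from fun_cong[OF this, of n] show False
    by simp
qed

lemma countable_lesspoll_Cantor:
  assumes "countable A"
  shows "A \<prec> (UNIV :: (nat \<Rightarrow> bool) set)"
proof -
  have "\<not> (UNIV :: (nat \<Rightarrow> bool) set) \<lesssim> A"
    using assms uncountable_Cantor countable_lepoll by blast
  then show ?thesis
    unfolding lesspoll_iff_card_of_ordLess lepoll_def by (metis card_of_ordLess)
qed

section \<open>Pseudointersections from Martin's Axiom\<close>

text \<open>
  Martin's Axiom makes the pseudointersection number equal to the continuum. Mathias-like forcing adds the pseudointersection: a condition
  is a pair of a finite stem, an initial approximation to \<open>x\<close>, and a finite intersection of
  members of \<open>\<F>\<close> from which all further elements must be taken. The two components are
  interleaved into a single element of \<open>2\<^sup>\<omega>\<close>, so that the axiom applies to this poset.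
\<close>

lemma MA_pseudointersection:
  fixes \<F> :: "nat set set"
  assumes "martins_axiom" and small: "\<F> \<prec> (UNIV :: (nat \<Rightarrow> bool) set)"
    and sfip: "\<And>\<G>. finite \<G> \<Longrightarrow> \<G> \<subseteq> \<F> \<Longrightarrow> infinite (\<Inter>\<G>)"
  shows "\<exists>x. infinite x \<and> (\<forall>A\<in>\<F>. finite (x - A))"
proof -
  define st :: "(nat \<Rightarrow> bool) \<Rightarrow> nat set" where "st p = {n. p (2 * n)}" for p
  define pr :: "(nat \<Rightarrow> bool) \<Rightarrow> nat set" where "pr p = {n. p (2 * n + 1)}" for p
  have cond_eqI: "p = q" if "st p = st q" "pr p = pr q" for p q
  proof
    fix n
    show "p n = q n"
      using that unfolding st_def pr_def set_eq_iff mem_Collect_eq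
      by (cases "even n") (metis evenE, metis oddE)
  qed
  have cond_ex: "\<exists>p. st p = s \<and> pr p = A" for s A
  proof (intro exI[of _ "\<lambda>n. if even n then n div 2 \<in> s else n div 2 \<in> A"])
  qed (simp add: st_def pr_def)
  \<comment> \<open>The closure of \<open>\<F>\<close> under finite intersections; a finite intersection instead of the finite
    subfamily itself is what makes a condition codable by a real.\<close>
  define \<I> where "\<I> = {\<Inter>\<G> |\<G>. finite \<G> \<and> \<G> \<subseteq> \<F>}"
  have \<I>_Int: "A \<inter> B \<in> \<I>" if A: "A \<in> \<I>" and B: "B \<in> \<I>" for A B
  proof -
    obtain \<G> where \<G>: "finite \<G>" "\<G> \<subseteq> \<F>" "A = \<Inter>\<G>"
      using A unfolding \<I>_def by auto
    obtain \<H> where \<H>: "finite \<H>" "\<H> \<subseteq> \<F>" "B = \<Inter>\<H>"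
      using B unfolding \<I>_def by auto
    show ?thesis
      unfolding \<I>_def
      by (intro CollectI exI[of _ "\<G> \<union> \<H>"]) (use \<G> \<H> in \<open>simp add: Inter_Un_distrib\<close>)
  qed
  have \<I>_inf: "infinite A" if "A \<in> \<I>" for A
    using that sfip unfolding \<I>_def by auto
  have \<F>_\<I>: "A \<in> \<I>" if "A \<in> \<F>" for A
    unfolding \<I>_def using that by (intro CollectI exI[of _ "{A}"]) auto
  define P where "P = {p. finite (st p) \<and> pr p \<in> \<I>}"
  define r where "r = {(p, q). p \<in> P \<and> q \<in> P \<and> st q \<subseteq> st p \<and> pr p \<subseteq> pr q \<and> st p - st q \<subseteq> pr q}"
  have po: "partial_order_on P r"
    unfolding partial_order_on_def preorder_on_def
  proof (intro conjI)
    show "r \<subseteq> P \<times> P" "refl_on P r"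
      by (auto simp: refl_on_def r_def)
    show "trans r"
      unfolding r_def by (rule transI) blast
    show "antisym r"
      by (rule antisymI) (auto simp: r_def intro: cond_eqI)
  qed
  \<comment> \<open>Conditions with the same stem are compatible, and there are only countably many stems.\<close>
  have ccc: "ccc P r"
    unfolding ccc_def
  proof (intro allI impI)
    fix A assume A: "A \<subseteq> P" and anti: "\<forall>p\<in>A. \<forall>q\<in>A. p \<noteq> q \<longrightarrow> \<not> compatible_in P r p q"
    have "inj_on st A"
    proof (rule inj_onI, rule ccontr)
      fix p q assume pq: "p \<in> A" "q \<in> A" "st p = st q" "p \<noteq> q"
      obtain c where c: "st c = st p" "pr c = pr p \<inter> pr q"
        using cond_ex by blast
      have P: "p \<in> P" "q \<in> P"
        using pq A by auto
      then have "pr c \<in> \<I>"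
        unfolding c by (intro \<I>_Int) (auto simp: P_def)
      then have "c \<in> P" "(c, p) \<in> r" "(c, q) \<in> r"
        using P pq c by (auto simp: P_def r_def)
      then show False
        using anti pq unfolding compatible_in_def by blast
    qed
    moreover have "countable (st ` A)"
      using A by (intro countable_subset[OF _ countable_Collect_finite]) (auto simp: P_def)
    ultimately show "countable A"
      using countable_image_inj_on by blast
  qed
  \<comment> \<open>Meeting \<open>DA A\<close> makes \<open>x\<close> almost contained in \<open>A\<close>; meeting every \<open>DN n\<close> makes \<open>x\<close> infinite.\<close>
  define DA where "DA A = {p \<in> P. pr p \<subseteq> A}" for A
  define DN where "DN n = {p \<in> P. \<exists>m\<in>st p. n \<le> m}" for n
  have "dense_in_poset P r (DA A)" if "A \<in> \<F>" for A
    unfolding dense_in_poset_def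
  proof (intro conjI ballI)
    fix p assume p: "p \<in> P"
    obtain c where c: "st c = st p" "pr c = pr p \<inter> A"
      using cond_ex by blast
    have "pr c \<in> \<I>"
      unfolding c using p \<F>_\<I>[OF that] by (intro \<I>_Int) (auto simp: P_def)
    then have "c \<in> DA A" "(c, p) \<in> r"
      using p c by (auto simp: P_def r_def DA_def)
    then show "\<exists>d\<in>DA A. (d, p) \<in> r" by blast
  qed (auto simp: DA_def)
  moreover have "dense_in_poset P r (DN n)" for n
    unfolding dense_in_poset_def
  proof (intro conjI ballI)
    fix p assume p: "p \<in> P"
    then have "infinite (pr p)"
      by (simp add: P_def \<I>_inf)
    then obtain m where m: "m \<in> pr p" "n \<le> m"
      by (meson infinite_nat_iff_unbounded_le)
    obtain c where c: "st c = insert m (st p)" "pr c = pr p"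
      using cond_ex by blast
    have "c \<in> DN n" "(c, p) \<in> r"
      using p c m by (auto simp: P_def r_def DN_def)
    then show "\<exists>d\<in>DN n. (d, p) \<in> r" by blast
  qed (auto simp: DN_def)
  moreover have "DA ` \<F> \<union> range DN \<prec> (UNIV :: (nat \<Rightarrow> bool) set)"
    using uncountable_Cantor countable_finite
    by (intro lesspoll_Un image_lesspoll small countable_lesspoll_Cantor) auto
  moreover have "P \<noteq> {}"
  proof -
    obtain c where "st c = {}" "pr c = \<Inter>{}"
      using cond_ex by blast
    moreover have "\<Inter>{} \<in> \<I>"
      unfolding \<I>_def by (intro CollectI exI[of _ "{}"]) simp
    ultimately have "c \<in> P"
      unfolding P_def by simp
    then show ?thesis by blast
  qed
  ultimately have hyps: "P \<noteq> {} \<and> partial_order_on P r \<and> ccc P r \<and>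
      DA ` \<F> \<union> range DN \<prec> (UNIV :: (nat \<Rightarrow> bool) set) \<and>
      (\<forall>D\<in>DA ` \<F> \<union> range DN. dense_in_poset P r D)"
    using po ccc by blast
  obtain G where G: "filter_in_poset P r G"
    and meet: "\<forall>D\<in>DA ` \<F> \<union> range DN. G \<inter> D \<noteq> {}"
    using assms(1)[unfolded martins_axiom_def martins_axiom_on_def, rule_format, OF hyps] by blast
  define x where "x = \<Union>(st ` G)"
  have "\<exists>m\<in>x. n \<le> m" for n
  proof -
    have "G \<inter> DN n \<noteq> {}"
      using meet by simp
    then show ?thesis
      unfolding x_def DN_def by blast
  qed
  then have "infinite x"
    by (meson infinite_nat_iff_unbounded_le)
  moreover have "finite (x - A)" if "A \<in> \<F>" for A
  proof -
    have "G \<inter> DA A \<noteq> {}"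
      using meet that by simp
    then obtain p where p: "p \<in> G" "p \<in> P" "pr p \<subseteq> A"
      unfolding DA_def by blast
    have "k \<in> A" if k: "k \<in> x" "k \<notin> st p" for k
    proof -
      obtain q where q: "q \<in> G" "k \<in> st q"
        using k unfolding x_def by blast
      obtain c where "(c, p) \<in> r" "(c, q) \<in> r"
        using G p q unfolding filter_in_poset_def by blast
      then show ?thesis
        using p q k unfolding r_def by blast
    qed
    then have "x - A \<subseteq> st p" by blast
    then show ?thesis
      using p finite_subset unfolding P_def by blast
  qed
  ultimately show ?thesis by blast
qed

text \<open>
  A chain modulo finite sets has the strong finite intersection property: among finitely many
  members there is a least one modulo finite sets, and it is almost contained in the intersection.
\<close>

lemma MA_tower_bounded:
  fixes \<T> :: "nat set set"
  assumes "martins_axiom" "\<T> \<prec> (UNIV :: (nat \<Rightarrow> bool) set)"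
    and inf: "\<And>A. A \<in> \<T> \<Longrightarrow> infinite A"
    and chain: "\<And>A B. A \<in> \<T> \<Longrightarrow> B \<in> \<T> \<Longrightarrow> finite (A - B) \<or> finite (B - A)"
  shows "\<exists>x. infinite x \<and> (\<forall>A\<in>\<T>. finite (x - A))"
proof (rule MA_pseudointersection)
  fix \<G> assume \<G>: "finite \<G>" "\<G> \<subseteq> \<T>"
  show "infinite (\<Inter>\<G>)"
  proof (cases "\<G> = {}")
    case False
    from \<G>(1) False \<G>(2) have "\<exists>A\<in>\<G>. \<forall>B\<in>\<G>. finite (A - B)"
    proof (induction rule: finite_ne_induct)
      case (insert C \<G>)
      then obtain A where A: "A \<in> \<G>" "\<forall>B\<in>\<G>. finite (A - B)"
        by blast
      show ?case
      proof (cases "finite (A - C)")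
        case True
        then show ?thesis
          using A by blast
      next
        case False
        then have "finite (C - A)"
          using chain A insert.prems by blast
        then have "finite (C - B)" if "B \<in> \<G>" for B
          using A that by (intro finite_subset[of "C - B" "(C - A) \<union> (A - B)"]) auto
        then show ?thesis by auto
      qed
    qed auto
    then obtain A where A: "A \<in> \<G>" "\<forall>B\<in>\<G>. finite (A - B)"
      by blast
    then have "finite (A - \<Inter>\<G>)"
      using \<G>(1) by (intro finite_subset[of "A - \<Inter>\<G>" "\<Union>B\<in>\<G>. A - B"] finite_UN_I) auto
    then show ?thesis
      using A inf \<G>(2) by (meson Diff_infinite_finite subsetD)
  qed simp
qed (use assms in auto)

section \<open>Cylinder sets\<close>

definition determined_below :: "nat \<Rightarrow> nat set set \<Rightarrow> bool" where
  "determined_below m C \<longleftrightarrow> (\<forall>z w. z \<inter> {..<m} = w \<inter> {..<m} \<longrightarrow> z \<in> C \<longrightarrow> w \<in> C)"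

definition cylinders :: "nat set set set" where
  "cylinders = {C. \<exists>m. determined_below m C}"

lemma countable_cylinders: "countable cylinders"
proof -
  have "C \<in> (\<Union>m. (\<lambda>S. {z. z \<inter> {..<m} \<in> S}) ` Pow (Pow {..<m}))" if "determined_below m C" for C m
  proof -
    have "z \<in> C \<longleftrightarrow> z \<inter> {..<m} \<in> {w \<in> C. w \<subseteq> {..<m}}" for z
      using that unfolding determined_below_def
      by (metis (no_types, lifting) inf.idem inf_assoc inf_le2 mem_Collect_eq)
    then have eq: "C = {z. z \<inter> {..<m} \<in> {w \<in> C. w \<subseteq> {..<m}}}"
      by blast
    have "{w \<in> C. w \<subseteq> {..<m}} \<in> Pow (Pow {..<m})"
      by blast
    with eq show ?thesis
      by (intro UN_I[of m] image_eqI) auto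
  qed
  then have "cylinders \<subseteq> (\<Union>m. (\<lambda>S. {z. z \<inter> {..<m} \<in> S}) ` Pow (Pow {..<m}))"
    unfolding cylinders_def by blast
  then show ?thesis
    by (rule countable_subset) (intro countable_UN countableI_type countable_image countable_finite, simp)
qed

text \<open>
  An enumeration that repeats every cylinder set infinitely often. A \<open>\<gamma>\<close>-sequence can then be
  sought as an infinite set of indices, whether or not the cylinder sets in it are distinct.
\<close>

definition cyl :: "nat \<Rightarrow> nat set set" where
  "cyl n = from_nat_into cylinders (fst (prod_decode n))"

text \<open>
  The function \<open>from_nat_into\<close> stays inside \<open>cylinders\<close> because that set is nonempty.
\<close>

lemma UNIV_in_cylinders: "UNIV \<in> cylinders"
  by (simp add: cylinders_def determined_below_def)

lemma cyl_in_cylinders: "cyl n \<in> cylinders"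
  using UNIV_in_cylinders from_nat_into unfolding cyl_def by blast

lemma infinite_cyl_index:
  assumes "C \<in> cylinders"
  shows "infinite {n. cyl n = C}"
proof -
  obtain k where k: "from_nat_into cylinders k = C"
    using from_nat_into_surj[OF countable_cylinders assms] by blast
  have "inj (\<lambda>j. prod_encode (k, j))"
    by (rule injI) simp
  moreover have "range (\<lambda>j. prod_encode (k, j)) \<subseteq> {n. cyl n = C}"
    using k by (auto simp: cyl_def)
  ultimately show ?thesis
    by (meson infinite_UNIV_nat finite_imageD finite_subset)
qed

section \<open>Sparse infinite sets\<close>

text \<open>
  Choose \<open>k\<^sub>0 < k\<^sub>1 < \<dots>\<close> in \<open>x\<close> and indices \<open>n\<^sub>0 < n\<^sub>1 < \<dots>\<close> in \<open>P\<close> alternately. Almost all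
  cylinder sets with index in \<open>P\<close> contain each of the finitely many subsets of \<open>{..k\<^sub>i}\<close>; pick one, with index
  \<open>n\<^sub>i\<^sub>+\<^sub>1\<close>. It looks at finitely many coordinates only, so taking \<open>k\<^sub>i\<^sub>+\<^sub>1\<close> beyond them it contains
  every \<open>z\<close> without elements strictly between \<open>k\<^sub>i\<close> and \<open>k\<^sub>i\<^sub>+\<^sub>1\<close>. If \<open>z\<close> is almost contained in
  \<open>{k\<^sub>0, k\<^sub>1, \<dots>}\<close>, then this holds for almost all \<open>i\<close>.
\<close>

lemma thin_to_gamma:
  assumes x: "infinite x" and P: "infinite P"
    and gam: "\<And>s. finite s \<Longrightarrow> finite {n \<in> P. s \<notin> cyl n}"
  shows "\<exists>y Q. y \<subseteq> x \<and> infinite y \<and> Q \<subseteq> P \<and> infinite Q \<and>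
    (\<forall>z. finite (z - y) \<longrightarrow> finite {n \<in> Q. z \<notin> cyl n})"
proof -
  have step: "\<exists>k' n'. k < k' \<and> k' \<in> x \<and> n < n' \<and> n' \<in> P \<and> (\<forall>z. z \<inter> {..<k'} \<subseteq> {..k} \<longrightarrow> z \<in> cyl n')"
    for k n :: nat
  proof -
    have "finite (\<Union>s\<in>Pow {..k}. {n \<in> P. s \<notin> cyl n})"
      using gam finite_subset by (intro finite_UN_I) auto
    then have "infinite (P - (\<Union>s\<in>Pow {..k}. {n \<in> P. s \<notin> cyl n}))"
      using P by (rule Diff_infinite_finite)
    then obtain n' where "n < n'" and new: "n' \<in> P - (\<Union>s\<in>Pow {..k}. {n \<in> P. s \<notin> cyl n})"
      by (meson infinite_nat_iff_unbounded)
    then have n': "n < n'" "n' \<in> P" "\<And>s. s \<subseteq> {..k} \<Longrightarrow> s \<in> cyl n'"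
      by auto
    obtain m where m: "determined_below m (cyl n')"
      using cyl_in_cylinders unfolding cylinders_def by blast
    obtain k' where k': "max k m < k'" "k' \<in> x"
      using x by (meson infinite_nat_iff_unbounded)
    have "z \<in> cyl n'" if "z \<inter> {..<k'} \<subseteq> {..k}" for z
    proof -
      have "(z \<inter> {..<k'}) \<inter> {..<m} = z \<inter> {..<m}"
        using k' by auto
      then show ?thesis
        using m n'(3)[OF that] unfolding determined_below_def by blast
    qed
    then show ?thesis
      using n' k' by (intro exI[of _ k'] exI[of _ n']) auto
  qed
  have "\<exists>f :: nat \<Rightarrow> nat \<times> nat. \<forall>i. (fst (f i) \<in> x \<and> snd (f i) \<in> P) \<and>
    (fst (f i) < fst (f (Suc i)) \<and> snd (f i) < snd (f (Suc i)) \<and>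
     (\<forall>z. z \<inter> {..<fst (f (Suc i))} \<subseteq> {..fst (f i)} \<longrightarrow> z \<in> cyl (snd (f (Suc i)))))"
  proof (rule dependent_nat_choice)
    show "\<exists>p. fst p \<in> x \<and> snd p \<in> P"
      using step by (metis fst_conv snd_conv)
  next
    fix p :: "nat \<times> nat" and i :: nat
    show "\<exists>q. (fst q \<in> x \<and> snd q \<in> P) \<and> fst p < fst q \<and> snd p < snd q \<and>
      (\<forall>z. z \<inter> {..<fst q} \<subseteq> {..fst p} \<longrightarrow> z \<in> cyl (snd q))"
      using step[of "fst p" "snd p"] by (metis fst_conv snd_conv)
  qed
  then obtain f :: "nat \<Rightarrow> nat \<times> nat" where f: "\<And>i. fst (f i) \<in> x" "\<And>i. snd (f i) \<in> P"
      "\<And>i. fst (f i) < fst (f (Suc i))" "\<And>i. snd (f i) < snd (f (Suc i))"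
      "\<And>i z. z \<inter> {..<fst (f (Suc i))} \<subseteq> {..fst (f i)} \<Longrightarrow> z \<in> cyl (snd (f (Suc i)))"
    by blast
  define k where "k i = fst (f i)" for i
  define q where "q i = snd (f i)" for i
  have sm: "strict_mono k" "strict_mono q"
    using f by (auto simp: k_def q_def strict_mono_Suc_iff)
  \<comment> \<open>Beyond \<open>m\<close> all elements of \<open>z\<close> are among the \<open>k\<^sub>j\<close>, and \<open>i \<le> k\<^sub>i\<close>; hence for \<open>m \<le> i\<close> the
    set \<open>z\<close> has no element in the gap between \<open>k\<^sub>i\<close> and \<open>k\<^sub>i\<^sub>+\<^sub>1\<close>.\<close>
  have "finite {n \<in> range q. z \<notin> cyl n}" if fin: "finite (z - range k)" for z
  proof -
    obtain m where m: "\<And>e. e \<in> z - range k \<Longrightarrow> e < m"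
      using fin finite_nat_set_iff_bounded[of "z - range k"] by auto
    have "z \<in> cyl (q (Suc i))" if "m \<le> i" for i
    proof -
      have "e \<le> k i" if e: "e \<in> z" "e < k (Suc i)" for e
      proof (cases "e \<in> range k")
        case True
        then obtain j where "e = k j" by blast
        then show ?thesis
          using e sm(1) by (simp add: strict_mono_less strict_mono_less_eq)
      next
        case False
        then have "e < m" using m e by blast
        then show ?thesis
          using \<open>m \<le> i\<close> seq_suble[OF sm(1), of i] by linarith
      qed
      then show ?thesis
        using f(5)[of z i] by (auto simp: k_def q_def)
    qed
    then have in_cyl: "z \<in> cyl (q j)" if "m < j" for j
      using that by (cases j) auto
    have "{n \<in> range q. z \<notin> cyl n} \<subseteq> q ` {..m}"
    proof clarify
      fix j assume "z \<notin> cyl (q j)"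
      then have "\<not> m < j" using in_cyl by blast
      then show "q j \<in> q ` {..m}" by simp
    qed
    then show ?thesis
      by (rule finite_subset) simp
  qed
  moreover have "infinite (range k)" "infinite (range q)"
    using sm by (simp_all add: finite_image_iff range_inj_infinite strict_mono_imp_inj_on)
  moreover have "range k \<subseteq> x" "range q \<subseteq> P"
    using f by (auto simp: k_def q_def)
  ultimately show ?thesis by blast
qed

text \<open>
  Here \<open>W n\<close> are open sets, and the sets with even (odd) index contain all finite sets of even
  (odd) size. Build \<open>x\<close> as an increasing union of finite sets \<open>s n\<close> of size \<open>n\<close>: as \<open>s n \<in> W n\<close>,
  a bounded part of \<open>s n\<close> already forces membership in \<open>W n\<close>, and all later elements are
  chosen above that bound. Adding one element at a time makes the parities alternate.
\<close>

lemma infinite_subset_in_all_open: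
  fixes W :: "nat \<Rightarrow> nat set set"
  assumes y: "infinite y"
    and op: "\<And>n z. z \<in> W n \<Longrightarrow> \<exists>m. \<forall>w. w \<inter> {..<m} = z \<inter> {..<m} \<longrightarrow> w \<in> W n"
    and dense: "\<And>n s. finite s \<Longrightarrow> even (card s) = even n \<Longrightarrow> s \<in> W n"
  shows "\<exists>x\<subseteq>y. infinite x \<and> (\<forall>n. x \<in> W n)"
proof -
  have "\<exists>s. \<forall>n. (finite (s n) \<and> card (s n) = n \<and> s n \<subseteq> y) \<and>
    (\<exists>k\<in>y. s (Suc n) = insert k (s n) \<and> s n \<subseteq> {..<k} \<and> (\<forall>w. w \<inter> {..<k} = s n \<longrightarrow> w \<in> W n))"
  proof (rule dependent_nat_choice)
    show "\<exists>s. finite s \<and> card s = 0 \<and> s \<subseteq> y"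
      by (intro exI[of _ "{}"]) simp
  next
    fix s n assume s: "finite s \<and> card s = n \<and> s \<subseteq> y"
    then have "s \<in> W n" using dense by blast
    then obtain m where m: "\<forall>w. w \<inter> {..<m} = s \<inter> {..<m} \<longrightarrow> w \<in> W n"
      using op by blast
    obtain b where b: "s \<subseteq> {..<b}"
      using s finite_nat_iff_bounded by blast
    obtain k where k: "k \<in> y" "max m b < k"
      using y by (meson infinite_nat_iff_unbounded)
    have sk: "s \<subseteq> {..<k}" using b k by auto
    have "w \<in> W n" if "w \<inter> {..<k} = s" for w
    proof -
      have "w \<inter> {..<m} = s \<inter> {..<m}"
        using that k by auto
      then show ?thesis using m by blast
    qed
    moreover have "card (insert k s) = Suc n"
      using s sk by (subst card_insert_disjoint) auto
    ultimately show "\<exists>s'. (finite s' \<and> card s' = Suc n \<and> s' \<subseteq> y) \<and>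
        (\<exists>k\<in>y. s' = insert k s \<and> s \<subseteq> {..<k} \<and> (\<forall>w. w \<inter> {..<k} = s \<longrightarrow> w \<in> W n))"
      using s k sk by (intro exI[of _ "insert k s"]) auto
  qed
  then obtain s where s0: "\<forall>n. (finite (s n) \<and> card (s n) = n \<and> s n \<subseteq> y) \<and>
    (\<exists>k\<in>y. s (Suc n) = insert k (s n) \<and> s n \<subseteq> {..<k} \<and> (\<forall>w. w \<inter> {..<k} = s n \<longrightarrow> w \<in> W n))" ..
  then have s: "\<And>n. finite (s n)" "\<And>n. card (s n) = n" "\<And>n. s n \<subseteq> y"
    by simp_all
  from s0 have "\<forall>n. \<exists>k. s (Suc n) = insert k (s n) \<and> s n \<subseteq> {..<k} \<and> (\<forall>w. w \<inter> {..<k} = s n \<longrightarrow> w \<in> W n)"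
    by blast
  from choice[OF this] obtain k where k: "\<And>n. s (Suc n) = insert (k n) (s n)" "\<And>n. s n \<subseteq> {..<k n}"
      "\<And>n w. w \<inter> {..<k n} = s n \<Longrightarrow> w \<in> W n"
    by auto
  have mono: "k n \<le> k m" if "n \<le> m" for n m
    using that
  proof (induction rule: dec_induct)
    case (step m)
    have "k m < k (Suc m)"
      using k(1)[of m] k(2)[of "Suc m"] by auto
    with step show ?case by simp
  qed simp
  have old: "e \<in> s n" if "e \<in> s m" "e < k n" for e m n
    using that
  proof (induction m)
    case 0
    then show ?case using s(1,2)[of 0] by simp
  next
    case (Suc m)
    show ?case
    proof (cases "e \<in> s m")
      case False
      then have "e = k m" using Suc k(1) by auto
      then have "m < n" using mono[of n m] Suc.prems by (meson not_le)
      then have "s (Suc m) \<subseteq> s n"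
        using k(1) by (intro lift_Suc_mono_le[of s _ n, OF _ Suc_leI]) auto
      then show ?thesis using Suc.prems by blast
    qed (use Suc in blast)
  qed
  have "(\<Union>n. s n) \<inter> {..<k n} = s n" for n
    using old k(2)[of n] by blast
  then have "(\<Union>n. s n) \<in> W n" for n
    using k(3) by blast
  moreover have "infinite (\<Union>n. s n)"
  proof
    assume fin: "finite (\<Union>n. s n)"
    have "card (s (Suc (card (\<Union>n. s n)))) \<le> card (\<Union>n. s n)"
      by (rule card_mono[OF fin]) blast
    then show False using s(2) by simp
  qed
  moreover have "(\<Union>n. s n) \<subseteq> y" using s by blast
  ultimately show ?thesis by blast
qed

section \<open>Codes for covers and for pairs of G-delta sets\<close>

text \<open>
  A real \<open>a\<close> is read in two independent ways: as the family of all \<open>cyl n\<close> with \<open>a n\<close>, and as a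
  sequence of open sets. Every family of cylinder sets and every sequence of open sets has a code,
  so continuum many stages suffice.
\<close>

definition omega_code :: "(nat \<Rightarrow> bool) \<Rightarrow> nat set set \<Rightarrow> bool" where
  "omega_code a A \<longleftrightarrow> (\<forall>F. finite F \<and> F \<subseteq> A \<longrightarrow> infinite {n. a n \<and> F \<subseteq> cyl n})"

definition gamma_code :: "(nat \<Rightarrow> bool) \<Rightarrow> nat set set \<Rightarrow> bool" where
  "gamma_code a A \<longleftrightarrow> (\<exists>Q\<subseteq>Collect a. infinite Q \<and> (\<forall>z\<in>A. finite {n \<in> Q. z \<notin> cyl n}))"

definition open_code :: "(nat \<Rightarrow> bool) \<Rightarrow> nat \<Rightarrow> nat set set" where
  "open_code a k = \<Union>{cyl n |n. a (prod_encode (k, n))}"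

text \<open>
  The open sets with even index have an intersection that contains every finite set of even size,
  those with odd index have one that contains every finite set of odd size. Such an \<open>a\<close> codes a
  candidate for separating these two countable sets by a set and its complement, both \<open>G\<^sub>\<delta>\<close>.
\<close>

definition separator_code :: "(nat \<Rightarrow> bool) \<Rightarrow> bool" where
  "separator_code a \<longleftrightarrow> (\<forall>k s. finite s \<and> even (card s) = even k \<longrightarrow> s \<in> open_code a k)"

lemma omega_code_mono: "omega_code a B \<Longrightarrow> A \<subseteq> B \<Longrightarrow> omega_code a A"
  unfolding omega_code_def by (meson order_trans)

lemma gamma_code_mono: "gamma_code a B \<Longrightarrow> A \<subseteq> B \<Longrightarrow> gamma_code a A"
  unfolding gamma_code_def by (meson subsetD)

text \<open>
  Sets of size less than the continuum have the \<open>\<gamma>\<close>-property: a \<open>\<gamma>\<close>-sequence is a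
  pseudointersection of the index sets \<open>{n. a n \<and> z \<in> cyl n}\<close>, and that these have infinite finite
  intersections is exactly what it means for \<open>a\<close> to code an \<open>\<omega>\<close>-cover.
\<close>

lemma MA_gamma_code:
  assumes MA: "martins_axiom" and small: "A \<prec> (UNIV :: (nat \<Rightarrow> bool) set)"
    and \<omega>: "omega_code a A"
  shows "gamma_code a A"
proof -
  define N where "N z = {n. a n \<and> z \<in> cyl n}" for z
  have "\<exists>P. infinite P \<and> (\<forall>B\<in>insert (Collect a) (N ` A). finite (P - B))"
  proof (rule MA_pseudointersection[OF MA])
    have "{Collect a} \<union> N ` A \<prec> (UNIV :: (nat \<Rightarrow> bool) set)"
      using uncountable_Cantor countable_finite
      by (intro lesspoll_Un image_lesspoll small countable_lesspoll_Cantor) auto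
    then show "insert (Collect a) (N ` A) \<prec> (UNIV :: (nat \<Rightarrow> bool) set)"
      by simp
  next
    fix \<G> assume \<G>: "finite \<G>" "\<G> \<subseteq> insert (Collect a) (N ` A)"
    then have "finite (\<G> - {Collect a})" "\<G> - {Collect a} \<subseteq> N ` A"
      by auto
    then obtain F where F: "F \<subseteq> A" "finite F" "\<G> - {Collect a} = N ` F"
      by (meson finite_subset_image)
    then have "\<G> \<subseteq> insert (Collect a) (N ` F)"
      by blast
    then have "{n. a n \<and> F \<subseteq> cyl n} \<subseteq> \<Inter>\<G>"
      unfolding N_def by blast
    moreover have "infinite {n. a n \<and> F \<subseteq> cyl n}"
      using F \<omega> unfolding omega_code_def by simp
    ultimately show "infinite (\<Inter>\<G>)"
      using infinite_super by blast
  qed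
  then obtain P where P: "infinite P" "finite (P - Collect a)" "\<And>z. z \<in> A \<Longrightarrow> finite (P - N z)"
    by auto
  have "infinite (P \<inter> Collect a)"
  proof
    assume "finite (P \<inter> Collect a)"
    then have "finite ((P \<inter> Collect a) \<union> (P - Collect a))"
      using P(2) by simp
    then show False
      using P(1) by (simp add: Int_Diff_Un)
  qed
  moreover have "finite {n \<in> P \<inter> Collect a. z \<notin> cyl n}" if "z \<in> A" for z
    by (rule finite_subset[OF _ P(3)[OF that]]) (auto simp: N_def)
  ultimately show ?thesis
    unfolding gamma_code_def by (intro exI[of _ "P \<inter> Collect a"]) simp
qed

section \<open>The tower\<close>

text \<open>
  One stage of the recursion. Being a lower bound and protecting a \<open>\<gamma>\<close>-sequence are inherited by
  infinite subsets, membership in the open sets is not and is arranged last: first a lower bound \<open>u\<close> of the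
  tower, inside it a set \<open>y\<close> that protects a \<open>\<gamma>\<close>-sequence, and inside \<open>y\<close> the set \<open>x\<close>.
\<close>

lemma tower_step:
  fixes \<T> :: "nat set set"
  assumes MA: "martins_axiom" and small: "\<T> \<prec> (UNIV :: (nat \<Rightarrow> bool) set)"
    and inf: "\<And>A. A \<in> \<T> \<Longrightarrow> infinite A"
    and chain: "\<And>A B. A \<in> \<T> \<Longrightarrow> B \<in> \<T> \<Longrightarrow> finite (A - B) \<or> finite (B - A)"
  shows "\<exists>x. infinite x \<and> (\<forall>A\<in>\<T>. finite (x - A)) \<and>
    (omega_code a (Collect finite \<union> \<T>) \<longrightarrow>
      gamma_code a (Collect finite \<union> \<T> \<union> {z. finite (z - x)})) \<and>
    (separator_code a \<longrightarrow> (\<forall>k. x \<in> open_code a k))"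
proof -
  obtain u where u: "infinite u" "\<forall>A\<in>\<T>. finite (u - A)"
    using MA_tower_bounded[OF MA small inf chain] by blast
  obtain y where y: "y \<subseteq> u" "infinite y"
    and y_gamma: "omega_code a (Collect finite \<union> \<T>) \<Longrightarrow>
      gamma_code a (Collect finite \<union> \<T> \<union> {z. finite (z - y)})"
  proof (cases "omega_code a (Collect finite \<union> \<T>)")
    case True
    have "Collect finite \<union> \<T> \<prec> (UNIV :: (nat \<Rightarrow> bool) set)"
      using uncountable_Cantor countable_finite
      by (intro lesspoll_Un small countable_lesspoll_Cantor countable_Collect_finite) auto
    from MA_gamma_code[OF MA this True] obtain P where P: "P \<subseteq> Collect a" "infinite P"
      "\<And>z. z \<in> Collect finite \<union> \<T> \<Longrightarrow> finite {n \<in> P. z \<notin> cyl n}"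
      unfolding gamma_code_def by blast
    have "finite {n \<in> P. s \<notin> cyl n}" if "finite s" for s
      using P(3) that by simp
    from thin_to_gamma[OF u(1) P(2) this]
    obtain y Q where yQ: "y \<subseteq> u" "infinite y" "Q \<subseteq> P" "infinite Q"
      "\<And>z. finite (z - y) \<Longrightarrow> finite {n \<in> Q. z \<notin> cyl n}"
      by blast
    have "finite {n \<in> Q. z \<notin> cyl n}" if "z \<in> Collect finite \<union> \<T>" for z
      using yQ(3) by (intro finite_subset[OF _ P(3)[OF that]]) auto
    then have "gamma_code a (Collect finite \<union> \<T> \<union> {z. finite (z - y)})"
      unfolding gamma_code_def using yQ P(1) by (intro exI[of _ Q]) auto
    then show ?thesis
      using that yQ by blast
  next
    case False
    then show ?thesis
      using that u by blast
  qed
  obtain x where x: "x \<subseteq> y" "infinite x" "separator_code a \<Longrightarrow> \<forall>k. x \<in> open_code a k"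
  proof (cases "separator_code a")
    case True
    have "\<exists>m. \<forall>w. w \<inter> {..<m} = z \<inter> {..<m} \<longrightarrow> w \<in> open_code a k" if z: "z \<in> open_code a k" for z k
    proof -
      obtain n where n: "a (prod_encode (k, n))" "z \<in> cyl n"
        using z unfolding open_code_def by blast
      obtain m where "determined_below m (cyl n)"
        using cyl_in_cylinders unfolding cylinders_def by blast
      then have "w \<in> cyl n" if "w \<inter> {..<m} = z \<inter> {..<m}" for w
        using that n(2) unfolding determined_below_def by metis
      then show ?thesis
        using n(1) unfolding open_code_def by blast
    qed
    moreover have "s \<in> open_code a k" if "finite s" "even (card s) = even k" for s k
      using True that unfolding separator_code_def by blast
    ultimately have "\<exists>x\<subseteq>y. infinite x \<and> (\<forall>k. x \<in> open_code a k)"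
      by (intro infinite_subset_in_all_open y(2))
    then show ?thesis
      using that by blast
  next
    case False
    then show ?thesis
      using that y by blast
  qed
  have "finite (x - A)" if "A \<in> \<T>" for A
    using u(2) that x(1) y(1) by (meson Diff_mono finite_subset order_refl order_trans)
  moreover have "finite (z - y)" if "finite (z - x)" for z
    using that x(1) by (meson Diff_mono finite_subset order_refl)
  then have "{z. finite (z - x)} \<subseteq> {z. finite (z - y)}"
    by blast
  then have "gamma_code a (Collect finite \<union> \<T> \<union> {z. finite (z - x)})"
    if "omega_code a (Collect finite \<union> \<T>)"
    using y_gamma[OF that] by (elim gamma_code_mono) blast
  ultimately show ?thesis
    using x by blast
qed

text \<open>
  The recursion runs along the cardinal well-order of \<open>2\<^sup>\<omega>\<close>, whose proper initial segments \<open>S a\<close>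
  are smaller than the continuum, as the stages require. A code \<open>a\<close> of an \<open>\<omega>\<close>-cover of the
  whole set is in particular one for what precedes stage \<open>a\<close>. The \<open>\<gamma>\<close>-sequence secured then
  works for the earlier points by choice, and for \<open>x\<^sub>a\<close> and the later points because they are
  almost contained in \<open>x\<^sub>a\<close>.
\<close>

lemma MA_diagonal_tower:
  assumes MA: "martins_axiom"
  shows "\<exists>\<T> :: nat set set. \<forall>a.
    (omega_code a (Collect finite \<union> \<T>) \<longrightarrow> gamma_code a (Collect finite \<union> \<T>)) \<and>
    (separator_code a \<longrightarrow> (\<exists>x\<in>\<T>. \<forall>k. x \<in> open_code a k))"
proof -
  define r where "r = card_of (UNIV :: (nat \<Rightarrow> bool) set)"
  define S where "S = underS r"
  have co: "Card_order r" and field: "Field r = UNIV"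
    unfolding r_def by (rule card_of_Card_order, rule Field_card_of)
  then have wo: "Well_order r"
    by (simp add: card_order_on_def)
  have small: "S a \<prec> (UNIV :: (nat \<Rightarrow> bool) set)" for a
    using card_of_underS[OF co, of a] field unfolding lesspoll_iff_card_of_ordLess r_def S_def by simp
  have total: "b = c \<or> b \<in> S c \<or> c \<in> S b" for b c
    using wo field unfolding S_def underS_def well_order_on_def linear_order_on_def total_on_def by blast
  have wf: "wf (r - Id)"
    using wo by (simp add: well_order_on_def)
  have S_iff: "(b, a) \<in> r - Id \<longleftrightarrow> b \<in> S a" for a b
    unfolding S_def underS_def by auto
  define good where "good f a x \<longleftrightarrow> infinite x \<and> (\<forall>A\<in>f ` S a. finite (x - A)) \<and>
    (omega_code a (Collect finite \<union> f ` S a) \<longrightarrow>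
      gamma_code a (Collect finite \<union> f ` S a \<union> {z. finite (z - x)})) \<and>
    (separator_code a \<longrightarrow> (\<forall>k. x \<in> open_code a k))" for f :: "(nat \<Rightarrow> bool) \<Rightarrow> nat set" and a x
  have "\<exists>f. \<forall>a. good f a (f a)"
  proof (rule dependent_wf_choice[OF wf])
    fix f g :: "(nat \<Rightarrow> bool) \<Rightarrow> nat set" and a x
    assume "\<And>z. (z, a) \<in> r - Id \<Longrightarrow> f z = g z"
    then have "f ` S a = g ` S a"
      unfolding S_iff by (intro image_cong) auto
    then show "good f a x = good g a x"
      unfolding good_def by simp
  next
    fix a and f :: "(nat \<Rightarrow> bool) \<Rightarrow> nat set"
    assume "\<And>b. (b, a) \<in> r - Id \<Longrightarrow> good f b (f b)"
    then have IH: "good f b (f b)" if "b \<in> S a" for b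
      using that unfolding S_iff by blast
    have "infinite A" if "A \<in> f ` S a" for A
      using that IH unfolding good_def by blast
    moreover have "finite (A - B) \<or> finite (B - A)" if AB: "A \<in> f ` S a" "B \<in> f ` S a" for A B
    proof -
      obtain b c where bc: "b \<in> S a" "A = f b" "c \<in> S a" "B = f c"
        using AB by blast
      have le: "finite (f d - f e)" if "d \<in> S a" "e \<in> S d" for d e
        using IH[OF that(1)] that(2) unfolding good_def by simp
      from total[of b c] show ?thesis
        using le[of b c] le[of c b] bc by auto
    qed
    ultimately show "\<exists>x. good f a x"
      unfolding good_def by (intro tower_step MA image_lesspoll small)
  qed
  then obtain f where f: "\<And>a. good f a (f a)"
    by blast
  have "gamma_code a (Collect finite \<union> range f)" if "omega_code a (Collect finite \<union> range f)" for a
  proof (rule gamma_code_mono)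
    have "omega_code a (Collect finite \<union> f ` S a)"
      by (rule omega_code_mono[OF that]) blast
    then show "gamma_code a (Collect finite \<union> f ` S a \<union> {z. finite (z - f a)})"
      using f[of a] unfolding good_def by blast
    have "f c \<in> f ` S a \<union> {z. finite (z - f a)}" for c
      using total[of a c] f[of c] unfolding good_def by auto
    then show "Collect finite \<union> range f \<subseteq> Collect finite \<union> f ` S a \<union> {z. finite (z - f a)}"
      by blast
  qed
  moreover have "\<exists>x\<in>range f. \<forall>k. x \<in> open_code a k" if "separator_code a" for a
    using f[of a] that unfolding good_def by blast
  ultimately show ?thesis
    by blast
qed

section \<open>Passing to Cantor space\<close>

definition char_fun :: "nat set \<Rightarrow> nat \<Rightarrow> bool" where
  "char_fun z = (\<lambda>n. n \<in> z)"

lemma open_imp_determined: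
  assumes "open U" "char_fun z \<in> U"
  shows "\<exists>m. \<forall>w. w \<inter> {..<m} = z \<inter> {..<m} \<longrightarrow> char_fun w \<in> U"
proof -
  have "openin (product_topology (\<lambda>i. euclidean) UNIV) U"
    using assms(1) by (simp add: open_fun_def)
  from product_topology_open_contains_basis[OF this assms(2)]
  obtain B :: "nat \<Rightarrow> bool set" where B: "char_fun z \<in> PiE UNIV B" "finite {i. B i \<noteq> UNIV}" "PiE UNIV B \<subseteq> U"
    by auto
  obtain m where m: "\<And>i. B i \<noteq> UNIV \<Longrightarrow> i < m"
    using B(2) finite_nat_set_iff_bounded[of "{i. B i \<noteq> UNIV}"] by auto
  have "char_fun w \<in> U" if w: "w \<inter> {..<m} = z \<inter> {..<m}" for w
  proof -
    have "char_fun w i \<in> B i" for i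
    proof (cases "B i = UNIV")
      case False
      then have "char_fun w i = char_fun z i"
        using m[of i] w unfolding char_fun_def by blast
      then show ?thesis
        using B(1) by (auto simp: PiE_iff)
    qed simp
    then show ?thesis
      using B(3) by (auto simp: PiE_iff)
  qed
  then show ?thesis by blast
qed

lemma open_family_code:
  assumes "\<And>k. open (V k)"
  shows "\<exists>a. \<forall>k. open_code a k = {z. char_fun z \<in> V k}"
proof (intro exI allI equalityI subsetI)
  let ?a = "\<lambda>j. cyl (snd (prod_decode j)) \<subseteq> {z. char_fun z \<in> V (fst (prod_decode j))}"
  fix k z
  show "z \<in> {z. char_fun z \<in> V k}" if "z \<in> open_code ?a k"
    using that unfolding open_code_def by auto
  show "z \<in> open_code ?a k" if z: "z \<in> {z. char_fun z \<in> V k}"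
  proof -
    obtain m where m: "\<And>w. w \<inter> {..<m} = z \<inter> {..<m} \<Longrightarrow> char_fun w \<in> V k"
      using open_imp_determined[OF assms[of k], of z] z by blast
    let ?C = "{w. w \<inter> {..<m} = z \<inter> {..<m}}"
    have "?C \<in> cylinders"
      unfolding cylinders_def determined_below_def by blast
    then obtain n where "cyl n = ?C"
      using infinite_cyl_index not_finite_existsD by blast
    then have "?a (prod_encode (k, n))" "z \<in> cyl n"
      using m by auto
    then show ?thesis
      unfolding open_code_def by blast
  qed
qed

text \<open>
  A cover \<open>\<U>\<close> by open sets is replaced by the family of all cylinder sets whose trace on the set is
  contained in some member of \<open>\<U>\<close>. This family is still an \<open>\<omega>\<close>-cover, since finitely many points of
  an open set lie in a cylinder set inside it. Conversely, enlarging the cylinder sets of a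
  \<open>\<gamma>\<close>-sequence to members of \<open>\<U>\<close> gives a \<open>\<gamma>\<close>-cover. It is infinite: a member of \<open>\<U>\<close> that is used
  infinitely often contains every point, but the whole set is not a member of an \<open>\<omega>\<close>-cover.
\<close>

lemma gamma_setI_codes:
  fixes A :: "nat set set"
  assumes codes: "\<And>a. omega_code a A \<Longrightarrow> gamma_code a A"
  shows "gamma_set (char_fun ` A)"
  unfolding gamma_set_def
proof (intro allI impI, elim conjE)
  fix \<U>
  let ?X = "char_fun ` A"
  assume op: "\<forall>U\<in>\<U>. openin (top_of_set ?X) U" and cover: "omega_cover ?X \<U>"
  define B where "B = {C \<in> cylinders. \<exists>U\<in>\<U>. \<forall>z\<in>A. z \<in> C \<longrightarrow> char_fun z \<in> U}"
  have "omega_code (\<lambda>n. cyl n \<in> B) A"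
    unfolding omega_code_def
  proof (intro allI impI, elim conjE)
    fix F assume F: "finite F" "F \<subseteq> A"
    then obtain U where U: "U \<in> \<U>" "char_fun ` F \<subseteq> U"
      using cover unfolding omega_cover_def by (meson finite_imageI image_mono)
    then obtain T where T: "open T" "U = ?X \<inter> T"
      using op by (meson openin_open)
    have "\<forall>z\<in>F. \<exists>m. \<forall>w. w \<inter> {..<m} = z \<inter> {..<m} \<longrightarrow> char_fun w \<in> T"
      using U T by (intro ballI open_imp_determined) auto
    from bchoice[OF this] obtain m
      where m: "\<And>z w. z \<in> F \<Longrightarrow> w \<inter> {..<m z} = z \<inter> {..<m z} \<Longrightarrow> char_fun w \<in> T"
      by auto
    obtain M where M: "\<And>z. z \<in> F \<Longrightarrow> m z \<le> M"
      using F(1) finite_nat_set_iff_bounded_le[of "m ` F"] by auto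
    \<comment> \<open>One cylinder set around all points of \<open>F\<close> at once, determined by enough coordinates \<open>M\<close> for each
      of them.\<close>
    define C where "C = {w. \<exists>z\<in>F. w \<inter> {..<M} = z \<inter> {..<M}}"
    have "char_fun w \<in> U" if w: "w \<in> A" "w \<in> C" for w
    proof -
      obtain z where z: "z \<in> F" "w \<inter> {..<M} = z \<inter> {..<M}"
        using w unfolding C_def by blast
      have "w \<inter> {..<m z} = (w \<inter> {..<M}) \<inter> {..<m z}" "z \<inter> {..<m z} = (z \<inter> {..<M}) \<inter> {..<m z}"
        using M[OF z(1)] by auto
      then show ?thesis
        using m[OF z(1), of w] z(2) w(1) T(2) by auto
    qed
    moreover have C: "C \<in> cylinders"
      unfolding cylinders_def determined_below_def C_def by (intro CollectI exI[of _ M]) auto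
    ultimately have "C \<in> B"
      using U(1) unfolding B_def by blast
    moreover have "F \<subseteq> C"
      unfolding C_def by blast
    ultimately have "{n. cyl n = C} \<subseteq> {n. cyl n \<in> B \<and> F \<subseteq> cyl n}"
      by blast
    then show "infinite {n. cyl n \<in> B \<and> F \<subseteq> cyl n}"
      using infinite_cyl_index[OF C] infinite_super by blast
  qed
  from codes[OF this] obtain Q where Q: "Q \<subseteq> {n. cyl n \<in> B}" "infinite Q"
    and Q_gamma: "\<And>z. z \<in> A \<Longrightarrow> finite {n \<in> Q. z \<notin> cyl n}"
    unfolding gamma_code_def by auto
  have "\<forall>n\<in>Q. \<exists>U. U \<in> \<U> \<and> (\<forall>z\<in>A. z \<in> cyl n \<longrightarrow> char_fun z \<in> U)"
    using Q(1) unfolding B_def by blast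
  from bchoice[OF this] obtain U
    where U: "\<And>n. n \<in> Q \<Longrightarrow> U n \<in> \<U>" "\<And>n z. n \<in> Q \<Longrightarrow> z \<in> A \<Longrightarrow> z \<in> cyl n \<Longrightarrow> char_fun z \<in> U n"
    by auto
  have miss: "finite {n \<in> Q. x \<notin> U n}" if x: "x \<in> ?X" for x
  proof -
    obtain z where z: "z \<in> A" "x = char_fun z"
      using x by blast
    show ?thesis
      using U(2) z by (intro finite_subset[OF _ Q_gamma[OF z(1)]]) auto
  qed
  have hit: "\<exists>n\<in>R. x \<in> U n" if "R \<subseteq> Q" "infinite R" "x \<in> ?X" for R x
  proof (rule ccontr)
    assume "\<not> (\<exists>n\<in>R. x \<in> U n)"
    then have "R \<subseteq> {n \<in> Q. x \<notin> U n}"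
      using that(1) by blast
    then show False
      using miss[OF that(3)] that(2) finite_subset by blast
  qed
  have "infinite (U ` Q)"
  proof
    assume "finite (U ` Q)"
    then obtain n where n: "n \<in> Q" "infinite {k \<in> Q. U k = U n}"
      using pigeonhole_infinite[OF Q(2)] by blast
    have "x \<in> U n" if "x \<in> ?X" for x
      using hit[OF _ n(2) that] by auto
    moreover have "U n \<subseteq> ?X"
      using op U(1)[OF n(1)] openin_imp_subset by blast
    ultimately have "U n = ?X"
      by blast
    then show False
      using cover U(1)[OF n(1)] unfolding omega_cover_def by simp
  qed
  moreover have "?X \<subseteq> \<Union>(U ` Q)"
    using hit[OF order_refl Q(2)] by blast
  moreover have "finite {V \<in> U ` Q. x \<notin> V}" if "x \<in> ?X" for x
    by (rule finite_subset[OF _ finite_imageI[OF miss[OF that], of U]]) blast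
  ultimately have "gamma_cover ?X (U ` Q)"
    unfolding gamma_cover_def by blast
  then show "\<exists>\<V>\<subseteq>\<U>. gamma_cover ?X \<V>"
    using U(1) by (intro exI[of _ "U ` Q"]) auto
qed

lemma gdelta_in_subspace_open_sequence:
  assumes "gdelta_in (top_of_set X) H"
  shows "\<exists>V :: nat \<Rightarrow> _. (\<forall>n. open (V n)) \<and> H = X \<inter> (\<Inter>n. V n)"
proof -
  obtain C :: "nat \<Rightarrow> _" where C: "\<forall>n. openin (top_of_set X) (C n)" "\<Inter>(range C) = H"
    using assms unfolding gdelta_in_descending by blast
  then have "\<forall>n. \<exists>V. open V \<and> C n = X \<inter> V"
    by (meson openin_open)
  from choice[OF this] obtain V where "\<forall>n. open (V n) \<and> C n = X \<inter> V n" ..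
  then show ?thesis
    using C(2) by (intro exI[of _ V]) auto
qed

text \<open>
  If \<open>H\<close> separates the finite sets of even size from those of odd size, then \<open>H\<close> and its
  complement are traces of \<open>G\<^sub>\<delta>\<close>-sets \<open>\<Inter>n. V n\<close> and \<open>\<Inter>n. W n\<close>. Interleaving the two sequences gives
  a separator code, and a point in all of the open sets would lie in \<open>H\<close> and in its complement.
\<close>

lemma not_weak_lambda_setI_codes:
  assumes fin: "Collect finite \<subseteq> A"
    and codes: "\<And>a. separator_code a \<Longrightarrow> \<exists>x\<in>A. \<forall>k. x \<in> open_code a k"
  shows "\<not> weak_lambda_set (char_fun ` A)"
proof
  let ?X = "char_fun ` A"
  let ?Y = "char_fun ` {s. finite s \<and> even (card s)}" and ?Z = "char_fun ` {s. finite s \<and> odd (card s)}"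
  assume wl: "weak_lambda_set ?X"
  have inj: "s = t" if "char_fun s = char_fun t" for s t
    using that unfolding char_fun_def by (meson set_eqI)
  have "?Y \<subseteq> ?X" "?Z \<subseteq> ?X"
    using fin by blast+
  moreover have "countable ?Y" "countable ?Z"
    by (auto intro!: countable_image countable_subset[OF _ countable_Collect_finite])
  moreover have "?Y \<inter> ?Z = {}"
    using inj by blast
  ultimately have "\<exists>H\<subseteq>?X. gdelta_in (top_of_set ?X) H \<and> fsigma_in (top_of_set ?X) H \<and>
      ?Y \<subseteq> H \<and> ?Z \<subseteq> ?X - H"
    using wl[unfolded weak_lambda_set_def, rule_format, of ?Y ?Z] by simp
  then obtain H where H: "gdelta_in (top_of_set ?X) H" "gdelta_in (top_of_set ?X) (?X - H)"
      "?Y \<subseteq> H" "?Z \<subseteq> ?X - H"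
    unfolding fsigma_in_gdelta_in by auto
  obtain V where V: "\<And>n :: nat. open (V n)" "H = ?X \<inter> (\<Inter>n. V n)"
    using gdelta_in_subspace_open_sequence[OF H(1)] by blast
  obtain W where W: "\<And>n :: nat. open (W n)" "?X - H = ?X \<inter> (\<Inter>n. W n)"
    using gdelta_in_subspace_open_sequence[OF H(2)] by blast
  have "\<And>k. open (if even k then V (k div 2) else W (k div 2))"
    using V(1) W(1) by simp
  from open_family_code[of "\<lambda>k. if even k then V (k div 2) else W (k div 2)", OF this] obtain a
    where a: "\<And>k. open_code a k = {z. char_fun z \<in> (if even k then V (k div 2) else W (k div 2))}"
    by blast
  have "char_fun s \<in> V n" if "finite s" "even (card s)" for s n
    using H(3) V(2) that by blast
  moreover have "char_fun s \<in> W n" if "finite s" "odd (card s)" for s n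
    using H(4) W(2) that by blast
  ultimately have "separator_code a"
    unfolding separator_code_def a by simp
  from codes[OF this] obtain x where x: "x \<in> A" "\<And>k. x \<in> open_code a k"
    by blast
  have "char_fun x \<in> V n" "char_fun x \<in> W n" for n
    using x(2)[of "2 * n"] x(2)[of "2 * n + 1"] unfolding a by simp_all
  then have "char_fun x \<in> H" "char_fun x \<in> ?X - H"
    using x(1) V(2) W(2) by blast+
  then show False
    by blast
qed

section \<open>The \<open>\<gamma>\<close>-set\<close>

theorem theorem2p3:
  assumes "martins_axiom"
  shows "\<exists>X :: (nat \<Rightarrow> bool) set. gamma_set X \<and> \<not> weak_lambda_set X"
proof -
  obtain \<T> :: "nat set set"
    where "\<And>a. omega_code a (Collect finite \<union> \<T>) \<Longrightarrow> gamma_code a (Collect finite \<union> \<T>)"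
      and "\<And>a. separator_code a \<Longrightarrow> \<exists>x\<in>\<T>. \<forall>k. x \<in> open_code a k"
    using MA_diagonal_tower[OF assms] by blast
  then have "gamma_set (char_fun ` (Collect finite \<union> \<T>))"
      "\<not> weak_lambda_set (char_fun ` (Collect finite \<union> \<T>))"
    by (blast intro: gamma_setI_codes, intro not_weak_lambda_setI_codes) blast+
  then show ?thesis
    by blast
qed

end
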